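(* $T[A]=T[H^\infty]\cap A$.
   Context: $\mathbb{D}$ is the open unit disk, $H(\mathbb{D})$ the set of analytic functions on $\mathbb{D}$, $H^\infty$ the Banach space of bounded analytic functions on $\mathbb{D}$ with the supremum norm, and $A$ the disk algebra (analytic functions on $\mathbb{D}$ that extend to be continuous on $\overline{\mathbb{D}}$), also with the supremum norm. For $g\in H(\mathbb{D})$, $T_gf(z)=\int_0^z f(t)g'(t)\,dt$ for $z\in\mathbb{D}$, $f\in H(\mathbb{D})$. For a Banach space $X\subseteq H(\mathbb{D})$, $T[X]=\{g\in H(\mathbb{D}):T_g\text{ is bounded on }X\}$, where bounded on $X$ means that $T_g$ maps $X$ into $X$ and is a bounded linear operator there. *)

theory Defs
  imports "HOL-Complex_Analysis.Complex_Analysis"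
begin

text \<open>Functions on the open unit disk are represented by total functions on the complex plane
  whose values outside the disk are irrelevant: every set of functions below is closed under
  changing values outside the disk, so equality of such sets is equality of the
  corresponding sets of functions on the disk.\<close>

abbreviation unit_disk :: "complex set" where
  "unit_disk \<equiv> ball 0 1"

definition H_disk :: "(complex \<Rightarrow> complex) set" where
  "H_disk = {f. f holomorphic_on unit_disk}"

definition H_infinity :: "(complex \<Rightarrow> complex) set" where
  "H_infinity = {f \<in> H_disk. bounded (f ` unit_disk)}"

definition disk_algebra :: "(complex \<Rightarrow> complex) set" where
  "disk_algebra = {f \<in> H_disk. \<exists>F. continuous_on (closure unit_disk) F \<and> (\<forall>z\<in>unit_disk. F z = f z)}"

text \<open>Meaningful only for functions that are bounded on the disk.\<close>

definition sup_norm :: "(complex \<Rightarrow> complex) \<Rightarrow> real" where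
  "sup_norm f = (SUP z\<in>unit_disk. norm (f z))"

text \<open>On the disk the integrand is analytic for analytic \<open>f\<close> and \<open>g\<close>, so the path from \<open>0\<close>
  to \<open>z\<close> within the disk is immaterial; the line segment is used.\<close>

definition T_op :: "(complex \<Rightarrow> complex) \<Rightarrow> (complex \<Rightarrow> complex) \<Rightarrow> complex \<Rightarrow> complex" where
  "T_op g f z = contour_integral (linepath 0 z) (\<lambda>t. f t * deriv g t)"

definition bounded_linear_operator_on ::
  "(complex \<Rightarrow> complex) set \<Rightarrow> ((complex \<Rightarrow> complex) \<Rightarrow> real) \<Rightarrow>
   ((complex \<Rightarrow> complex) \<Rightarrow> complex \<Rightarrow> complex) \<Rightarrow> bool" where
  "bounded_linear_operator_on X N L \<longleftrightarrow>
     (\<forall>f\<in>X. L f \<in> X) \<and>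
     (\<forall>f\<in>X. \<forall>h\<in>X. \<forall>a b. \<forall>z\<in>unit_disk.
        L (\<lambda>w. a * f w + b * h w) z = a * L f z + b * L h z) \<and>
     (\<exists>C. \<forall>f\<in>X. N (L f) \<le> C * N f)"

text \<open>The set \<open>T[X]\<close>, where \<open>N\<close> is the norm of \<open>X\<close>.\<close>

definition T_symbols ::
  "(complex \<Rightarrow> complex) set \<Rightarrow> ((complex \<Rightarrow> complex) \<Rightarrow> real) \<Rightarrow> (complex \<Rightarrow> complex) set" where
  "T_symbols X N = {g \<in> H_disk. bounded_linear_operator_on X N (T_op g)}"

end

theory Submission
  imports Defs
begin

text \<open>
  Two approximation arguments, both based on the dilations \<open>f\<^sub>r(z) = f(r z)\<close> with \<open>r\<close> tending to
  \<open>1\<close> from the left, give the two inclusions. Dilations of an analytic function are in the disk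
  algebra, and their sup norms are at most that of the function if it is bounded.

  If \<open>T\<^sub>g\<close> is bounded on the disk algebra, then \<open>g - g(0) = T\<^sub>g 1\<close> is in the disk algebra. For a
  bounded analytic \<open>f\<close>, the values \<open>T\<^sub>g f\<^sub>r(z)\<close> tend to \<open>T\<^sub>g f(z)\<close>, because \<open>f\<^sub>r\<close> tends to \<open>f\<close>
  uniformly on the segment from \<open>0\<close> to \<open>z\<close>; hence \<open>T\<^sub>g\<close> satisfies on \<open>H_infinity\<close> the bound that it
  satisfies on the disk algebra.

  Conversely, let \<open>T\<^sub>g\<close> be bounded on \<open>H_infinity\<close>, with \<open>g\<close> in the disk algebra. The norm bound is
  inherited by the disk algebra, so it remains to see that \<open>T\<^sub>g\<close> maps the disk algebra into
  itself. If \<open>f\<close> in the disk algebra has a bounded derivative, then \<open>T\<^sub>g f = f g - f(0) g(0) - Q\<close>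
  with \<open>Q(0) = 0\<close> and \<open>Q' = f' g\<close> bounded, so that \<open>Q\<close> is Lipschitz and \<open>T\<^sub>g f\<close> is in the disk
  algebra (\<open>T_op_in_disk_algebra\<close>). A general \<open>f\<close> in the disk algebra is the uniform limit of its
  dilations, which have bounded derivatives; boundedness of \<open>T\<^sub>g\<close> carries the uniform convergence
  over to the images, and the disk algebra is closed under uniform limits.
\<close>

section \<open>The sup norm and the disk algebra\<close>

lemma norm_le_sup_norm:
  assumes "f \<in> H_infinity" "z \<in> unit_disk"
  shows "norm (f z) \<le> sup_norm f"
proof -
  obtain B where "\<forall>w\<in>unit_disk. norm (f w) \<le> B"
    using assms(1) by (auto simp: H_infinity_def bounded_iff)
  then have "bdd_above ((\<lambda>w. norm (f w)) ` unit_disk)"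
    by (auto intro!: bdd_aboveI2)
  then show ?thesis
    unfolding sup_norm_def using assms(2) by (rule cSUP_upper2) simp
qed

lemma sup_norm_nonneg: "f \<in> H_infinity \<Longrightarrow> 0 \<le> sup_norm f"
  using norm_le_sup_norm[of f 0] norm_ge_zero[of "f 0"] by (simp del: norm_ge_zero)

lemma sup_norm_le:
  assumes "\<And>z. z \<in> unit_disk \<Longrightarrow> norm (f z) \<le> B"
  shows "sup_norm f \<le> B"
  unfolding sup_norm_def using assms by (intro cSUP_least) auto

text \<open>A function extends continuously to the compact closed disk exactly if it is uniformly
  continuous. This form makes no mention of the extension, so that limits and Lipschitz functions
  can be handled on the open disk alone.\<close>

lemma disk_algebra_iff_uniformly_continuous:
  "f \<in> disk_algebra \<longleftrightarrow> f holomorphic_on unit_disk \<and> uniformly_continuous_on unit_disk f"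
proof (intro iffI conjI)
  assume "f \<in> disk_algebra"
  then obtain F where hol: "f holomorphic_on unit_disk"
    and F: "continuous_on (closure unit_disk) F" "\<And>z. z \<in> unit_disk \<Longrightarrow> F z = f z"
    by (auto simp: disk_algebra_def H_disk_def)
  show "f holomorphic_on unit_disk" by (fact hol)
  have "uniformly_continuous_on (closure unit_disk) F"
    using F(1) by (intro compact_uniformly_continuous) auto
  then have "uniformly_continuous_on unit_disk F"
    unfolding uniformly_continuous_on_def using closure_subset by (meson subsetD)
  then show "uniformly_continuous_on unit_disk f"
    using F(2) by (simp add: uniformly_continuous_on_def)
next
  assume f: "f holomorphic_on unit_disk \<and> uniformly_continuous_on unit_disk f"
  then obtain F where "uniformly_continuous_on (closure unit_disk) F"
     "\<And>z. z \<in> unit_disk \<Longrightarrow> f z = F z"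
    using uniformly_continuous_on_extension_on_closure by metis
  with f show "f \<in> disk_algebra"
    unfolding disk_algebra_def H_disk_def
    by (fastforce dest: uniformly_continuous_imp_continuous)
qed

lemma disk_algebra_subset_H_infinity: "disk_algebra \<subseteq> H_infinity"
proof
  fix f assume "f \<in> disk_algebra"
  then have "f holomorphic_on unit_disk" "uniformly_continuous_on unit_disk f"
    by (auto simp: disk_algebra_iff_uniformly_continuous)
  then show "f \<in> H_infinity"
    using bounded_uniformly_continuous_image[of unit_disk f]
    by (simp add: H_infinity_def H_disk_def)
qed

lemma disk_algebra_cong:
  assumes "\<And>z. z \<in> unit_disk \<Longrightarrow> f z = h z"
  shows "f \<in> disk_algebra \<longleftrightarrow> h \<in> disk_algebra"
proof -
  have "f holomorphic_on unit_disk \<longleftrightarrow> h holomorphic_on unit_disk"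
    using assms by (rule holomorphic_cong[OF refl])
  then show ?thesis
    using assms by (simp add: disk_algebra_iff_uniformly_continuous uniformly_continuous_on_def)
qed

lemma disk_algebra_add_const: "f \<in> disk_algebra \<Longrightarrow> (\<lambda>z. f z + c) \<in> disk_algebra"
  unfolding disk_algebra_iff_uniformly_continuous
  by (auto intro!: holomorphic_intros uniformly_continuous_on_add uniformly_continuous_on_const)

lemma disk_algebra_diff:
  "f \<in> disk_algebra \<Longrightarrow> h \<in> disk_algebra \<Longrightarrow> (\<lambda>z. f z - h z) \<in> disk_algebra"
  unfolding disk_algebra_iff_uniformly_continuous
  by (auto intro!: holomorphic_intros uniformly_continuous_on_diff)

text \<open>Products of uniformly continuous functions need boundedness to be uniformly continuous;
  multiplying the extensions to the compact closed disk provides it.\<close>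

lemma disk_algebra_mult:
  assumes "f \<in> disk_algebra" "h \<in> disk_algebra"
  shows "(\<lambda>z. f z * h z) \<in> disk_algebra"
proof -
  obtain F H where "continuous_on (closure unit_disk) F" "\<forall>z\<in>unit_disk. F z = f z"
    "continuous_on (closure unit_disk) H" "\<forall>z\<in>unit_disk. H z = h z"
    using assms by (auto simp: disk_algebra_def)
  then have "continuous_on (closure unit_disk) (\<lambda>z. F z * H z)"
    "\<forall>z\<in>unit_disk. F z * H z = f z * h z"
    by (auto intro: continuous_on_mult)
  then show ?thesis
    using assms unfolding disk_algebra_def H_disk_def
    by (auto intro!: holomorphic_on_mult exI[of _ "\<lambda>z. F z * H z"])
qed

lemma disk_algebra_uniform_limit:
  assumes lim: "uniform_limit unit_disk u f F" and F: "F \<noteq> bot"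
    and u: "\<forall>\<^sub>F r in F. u r \<in> disk_algebra" and hol: "f holomorphic_on unit_disk"
  shows "f \<in> disk_algebra"
  unfolding disk_algebra_iff_uniformly_continuous
proof
  show "uniformly_continuous_on unit_disk f"
    unfolding uniformly_continuous_on_def
  proof (intro allI impI)
    fix e :: real assume "0 < e"
    then have "\<forall>\<^sub>F r in F. \<forall>z\<in>unit_disk. dist (u r z) (f z) < e / 3"
      using lim unfolding uniform_limit_iff by (meson divide_pos_pos zero_less_numeral)
    with u have "\<forall>\<^sub>F r in F. u r \<in> disk_algebra \<and> (\<forall>z\<in>unit_disk. dist (u r z) (f z) < e / 3)"
      by eventually_elim simp
    then obtain r where r: "u r \<in> disk_algebra" "\<And>z. z\<in>unit_disk \<Longrightarrow> dist (u r z) (f z) < e / 3"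
      using F eventually_happens' by blast
    then obtain d where d: "d > 0"
      "\<And>x y. x \<in> unit_disk \<Longrightarrow> y \<in> unit_disk \<Longrightarrow> dist y x < d \<Longrightarrow> dist (u r y) (u r x) < e / 3"
      using \<open>0 < e\<close> unfolding disk_algebra_iff_uniformly_continuous uniformly_continuous_on_def
      by (metis divide_pos_pos zero_less_numeral)
    have "dist (f y) (f x) < e" if "x \<in> unit_disk" "y \<in> unit_disk" "dist y x < d" for x y
      using r(2)[OF that(1)] r(2)[OF that(2)] d(2)[OF that]
      by (metis dist_commute dist_triangle_third)
    then show "\<exists>d>0. \<forall>x\<in>unit_disk. \<forall>y\<in>unit_disk. dist y x < d \<longrightarrow> dist (f y) (f x) < e"
      using d(1) by blast
  qed
qed (fact hol)

text \<open>By convexity of the disk such a function is Lipschitz.\<close>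

lemma disk_algebra_if_bounded_deriv:
  assumes der: "\<And>z. z \<in> unit_disk \<Longrightarrow> (Q has_field_derivative q z) (at z)"
    and bd: "bounded (q ` unit_disk)"
  shows "Q \<in> disk_algebra"
proof -
  obtain B where B: "B > 0" "\<And>z. z \<in> unit_disk \<Longrightarrow> norm (q z) \<le> B"
    using bd by (auto simp: bounded_pos)
  have lip: "norm (Q x - Q y) \<le> B * norm (x - y)" if "x \<in> unit_disk" "y \<in> unit_disk" for x y
    using that by (intro field_differentiable_bound[of unit_disk Q q])
      (auto intro: has_field_derivative_at_within[OF der] B(2))
  then have "B-lipschitz_on unit_disk Q"
    using B(1) by (intro lipschitz_onI) (auto simp: dist_norm)
  then have "uniformly_continuous_on unit_disk Q"
    by (rule lipschitz_on_uniformly_continuous)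
  moreover have "Q holomorphic_on unit_disk"
    using der holomorphic_on_open[OF open_ball] by blast
  ultimately show ?thesis
    by (simp add: disk_algebra_iff_uniformly_continuous)
qed

section \<open>Dilations\<close>

lemma eventually_at_left_one_in_unit_interval: "\<forall>\<^sub>F r in at_left (1::real). r \<in> {0<..<1}"
  by (intro eventually_at_left_real) simp

lemma dilation_mem:
  fixes z :: complex
  assumes "z \<in> unit_disk" "0 \<le> r" "r \<le> 1"
  shows "of_real r * z \<in> unit_disk"
  using assms mult_left_le_one_le[of "norm z" r] by (auto simp: norm_mult)

text \<open>Since \<open>\<bar>r z - z\<bar> \<le> 1 - r\<close> on the disk, uniform continuity gives uniform convergence. The set
  \<open>S\<close> is the whole disk for functions in the disk algebra, and a segment from the origin for
  arbitrary analytic functions.\<close>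

lemma dilation_uniform_limit:
  fixes f :: "complex \<Rightarrow> complex"
  assumes uc: "uniformly_continuous_on S f"
    and S: "S \<subseteq> unit_disk" "\<And>r z. 0 \<le> r \<Longrightarrow> r \<le> 1 \<Longrightarrow> z \<in> S \<Longrightarrow> of_real r * z \<in> S"
  shows "uniform_limit S (\<lambda>r z. f (of_real r * z)) f (at_left (1::real))"
  unfolding uniform_limit_iff
proof (intro allI impI)
  fix e :: real assume "0 < e"
  then obtain d where d: "d > 0"
    "\<And>x y. x \<in> S \<Longrightarrow> y \<in> S \<Longrightarrow> dist y x < d \<Longrightarrow> dist (f y) (f x) < e"
    using uc unfolding uniformly_continuous_on_def by metis
  have "\<forall>\<^sub>F r in at_left (1::real). r \<in> {max 0 (1 - d)<..<1}"
    using d(1) by (intro eventually_at_left_real) auto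
  then show "\<forall>\<^sub>F r in at_left (1::real). \<forall>z\<in>S. dist (f (of_real r * z)) (f z) < e"
  proof eventually_elim
    case (elim r)
    show ?case
    proof
      fix z assume z: "z \<in> S"
      have "dist (of_real r * z) z = norm (of_real (r - 1) * z)"
        by (simp add: dist_norm algebra_simps)
      also have "\<dots> = (1 - r) * norm z"
        unfolding norm_mult norm_of_real using elim by simp
      also have "\<dots> \<le> 1 - r"
        using elim z S(1) by (intro mult_left_le) auto
      also have "\<dots> < d" using elim by auto
      finally show "dist (f (of_real r * z)) (f z) < e"
        using d(2) z S(2)[of r z] elim by simp
    qed
  qed
qed

lemma dilation_in_disk_algebra:
  assumes hol: "f holomorphic_on unit_disk" and r: "0 \<le> r" "r < 1"
  shows "(\<lambda>z. f (of_real r * z)) \<in> disk_algebra"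
proof -
  have cl: "of_real r * z \<in> unit_disk" if "norm z \<le> 1" for z :: complex
    using r that mult_left_le[of "norm z" r] by (auto simp: norm_mult)
  have "continuous_on (closure unit_disk) (\<lambda>z. f (of_real r * z))"
    using cl by (intro continuous_on_compose2[OF holomorphic_on_imp_continuous_on[OF hol]])
      (auto intro!: continuous_intros)
  moreover have "(\<lambda>z. f (of_real r * z)) holomorphic_on unit_disk"
    using cl by (intro holomorphic_on_compose_gen[OF _ hol, unfolded o_def])
      (auto intro!: holomorphic_intros)
  ultimately show ?thesis
    unfolding disk_algebra_def H_disk_def by blast
qed

text \<open>The derivative is \<open>r\<close> times the dilation of \<open>deriv f\<close>, which is in the disk algebra and thus
  bounded.\<close>

lemma dilation_deriv_bounded:
  assumes hol: "f holomorphic_on unit_disk" and r: "0 \<le> r" "r < 1"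
  shows "bounded (deriv (\<lambda>z. f (of_real r * z)) ` unit_disk)"
proof -
  have "(\<lambda>z. deriv f (of_real r * z)) \<in> H_infinity"
    using dilation_in_disk_algebra[of "deriv f" r] hol r disk_algebra_subset_H_infinity
    by (auto intro: holomorphic_deriv)
  then obtain B where "\<forall>z\<in>unit_disk. norm (deriv f (of_real r * z)) \<le> B"
    by (auto simp: H_infinity_def bounded_iff)
  then have B: "\<And>z. z \<in> unit_disk \<Longrightarrow> norm (deriv f (of_real r * z)) \<le> B"
    by blast
  have "norm (deriv (\<lambda>z. f (of_real r * z)) z) \<le> r * B" if "z \<in> unit_disk" for z
  proof -
    have "(f has_field_derivative deriv f (of_real r * z)) (at (of_real r * z))"
      using hol dilation_mem[OF that] r by (intro holomorphic_derivI[of f unit_disk]) auto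
    then have "((\<lambda>z. f (of_real r * z)) has_field_derivative deriv f (of_real r * z) * of_real r) (at z)"
      by (intro DERIV_chain2[of f]) (auto intro!: derivative_eq_intros)
    then show ?thesis
      using mult_left_mono[OF B[OF that], of r] r
      by (simp add: DERIV_imp_deriv norm_mult mult.commute)
  qed
  then show ?thesis unfolding bounded_iff by blast
qed

section \<open>The integral operator\<close>

lemma holomorphic_disk_primitive:
  assumes "q holomorphic_on unit_disk"
  obtains Q where "\<And>z. z \<in> unit_disk \<Longrightarrow> (Q has_field_derivative q z) (at z)"
proof -
  obtain Q where "\<And>z. z \<in> unit_disk \<Longrightarrow> (Q has_field_derivative q z) (at z within unit_disk)"
    using holomorphic_convex_primitive'[OF convex_ball open_ball assms] by blast
  then show thesis
    by (intro that[of Q]) (simp add: at_within_open[OF _ open_ball])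
qed

text \<open>All properties of \<open>T_op\<close> below that are identities come from exhibiting a primitive.\<close>

lemma T_op_eq_primitive:
  assumes P: "\<And>w. w \<in> unit_disk \<Longrightarrow> (P has_field_derivative f w * deriv g w) (at w)"
    and z: "z \<in> unit_disk"
  shows "T_op g f z = P z - P 0"
proof -
  have "closed_segment 0 z \<subseteq> unit_disk"
    using z by (intro closed_segment_subset) auto
  then have "((\<lambda>t. f t * deriv g t) has_contour_integral (P z - P 0)) (linepath 0 z)"
    using contour_integral_primitive[of unit_disk P "\<lambda>t. f t * deriv g t" "linepath 0 z"] P
    by (auto intro: has_field_derivative_at_within)
  then show ?thesis
    unfolding T_op_def by (rule contour_integral_unique)
qed

lemma T_op_has_field_derivative:
  assumes "f holomorphic_on unit_disk" "g holomorphic_on unit_disk" "z \<in> unit_disk"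
  shows "(T_op g f has_field_derivative f z * deriv g z) (at z)"
proof -
  have "(\<lambda>w. f w * deriv g w) holomorphic_on unit_disk"
    using assms by (auto intro!: holomorphic_intros)
  then obtain P where P: "\<And>w. w \<in> unit_disk \<Longrightarrow> (P has_field_derivative f w * deriv g w) (at w)"
    using holomorphic_disk_primitive by blast
  have "((\<lambda>w. P w - P 0) has_field_derivative f z * deriv g z) (at z)"
    using P[OF assms(3)] by (auto intro!: derivative_eq_intros)
  then show ?thesis
    by (rule has_field_derivative_transform_within_open[of _ _ _ unit_disk])
      (use assms(3) T_op_eq_primitive[OF P] in auto)
qed

lemma T_op_holomorphic:
  assumes "f holomorphic_on unit_disk" "g holomorphic_on unit_disk"
  shows "T_op g f holomorphic_on unit_disk"
  using T_op_has_field_derivative[OF assms] holomorphic_on_open[OF open_ball] by blast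

lemma T_op_const_one:
  assumes "g holomorphic_on unit_disk" "z \<in> unit_disk"
  shows "T_op g (\<lambda>_. 1) z = g z - g 0"
  using assms by (intro T_op_eq_primitive) (auto intro: holomorphic_derivI)

lemma T_op_linear:
  assumes f: "f holomorphic_on unit_disk" and h: "h holomorphic_on unit_disk"
    and g: "g holomorphic_on unit_disk" and z: "z \<in> unit_disk"
  shows "T_op g (\<lambda>w. a * f w + b * h w) z = a * T_op g f z + b * T_op g h z"
proof -
  have "T_op g (\<lambda>w. a * f w + b * h w) z =
      (\<lambda>w. a * T_op g f w + b * T_op g h w) z - (\<lambda>w. a * T_op g f w + b * T_op g h w) 0"
    using z by (intro T_op_eq_primitive)
      (auto intro!: derivative_eq_intros T_op_has_field_derivative f h g simp: algebra_simps)
  then show ?thesis by (simp add: T_op_def)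
qed

text \<open>Integration by parts replaces \<open>deriv g\<close>, which may be unbounded, by \<open>deriv f\<close>: with \<open>Q\<close> a
  primitive of \<open>deriv f * g\<close>, the function \<open>f * g - Q\<close> is a primitive of \<open>f * deriv g\<close>.\<close>

lemma T_op_in_disk_algebra:
  assumes f: "f \<in> disk_algebra" "bounded (deriv f ` unit_disk)" and g: "g \<in> disk_algebra"
  shows "T_op g f \<in> disk_algebra"
proof -
  have hol: "f holomorphic_on unit_disk" "g holomorphic_on unit_disk"
    using f g by (auto simp: disk_algebra_iff_uniformly_continuous)
  then have "(\<lambda>w. deriv f w * g w) holomorphic_on unit_disk"
    by (auto intro!: holomorphic_intros)
  then obtain Q where Q: "\<And>w. w \<in> unit_disk \<Longrightarrow> (Q has_field_derivative deriv f w * g w) (at w)"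
    using holomorphic_disk_primitive by blast
  obtain B C where "\<forall>w\<in>unit_disk. norm (deriv f w) \<le> B" "\<forall>w\<in>unit_disk. norm (g w) \<le> C"
    using f(2) g disk_algebra_subset_H_infinity by (fastforce simp: H_infinity_def bounded_iff)
  then have "\<forall>w\<in>unit_disk. norm (deriv f w * g w) \<le> B * C"
    by (metis mult_mono' norm_ge_zero norm_mult)
  then have "bounded ((\<lambda>w. deriv f w * g w) ` unit_disk)"
    by (auto simp: bounded_iff)
  with Q have "Q \<in> disk_algebra" by (rule disk_algebra_if_bounded_deriv)
  define P where "P z = f z * g z - Q z" for z
  have "P \<in> disk_algebra"
    unfolding P_def using f(1) g \<open>Q \<in> disk_algebra\<close> by (intro disk_algebra_diff disk_algebra_mult)
  then have "(\<lambda>z. P z + - P 0) \<in> disk_algebra" by (rule disk_algebra_add_const)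
  moreover have "(P has_field_derivative f z * deriv g z) (at z)" if "z \<in> unit_disk" for z
    unfolding P_def
    using holomorphic_derivI[OF hol(1) open_ball that] holomorphic_derivI[OF hol(2) open_ball that] Q[OF that]
    by (auto intro!: derivative_eq_intros)
  then have "T_op g f z = P z + - P 0" if "z \<in> unit_disk" for z
    using T_op_eq_primitive[of P f g z] that by simp
  ultimately show ?thesis
    using disk_algebra_cong[of "T_op g f" "\<lambda>z. P z + - P 0"] by blast
qed

text \<open>The segment from \<open>0\<close> to \<open>z\<close> is compact in the disk and closed under multiplication by
  \<open>r \<in> {0..1}\<close>, so the integrands converge uniformly on it.\<close>

lemma T_op_dilation_tendsto:
  assumes f: "f holomorphic_on unit_disk" and g: "g holomorphic_on unit_disk"
    and z: "z \<in> unit_disk"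
  shows "((\<lambda>r. T_op g (\<lambda>w. f (of_real r * w)) z) \<longlongrightarrow> T_op g f z) (at_left (1::real))"
proof -
  let ?S = "closed_segment 0 z"
  have S: "?S \<subseteq> unit_disk"
    using z by (intro closed_segment_subset) auto
  have cont: "continuous_on ?S f" "continuous_on ?S (deriv g)"
    using holomorphic_on_imp_continuous_on[OF f] continuous_on_subset[OF _ S]
      holomorphic_on_imp_continuous_on[OF holomorphic_deriv[OF g open_ball]] by blast+
  have star: "of_real r * w \<in> ?S" if "0 \<le> r" "r \<le> 1" "w \<in> ?S" for r w
  proof -
    obtain t where t: "0 \<le> t" "t \<le> 1" "w = t *\<^sub>R z"
      using \<open>w \<in> ?S\<close> by (auto simp: in_segment)
    then have "of_real r * w = (r * t) *\<^sub>R z" "0 \<le> r * t" "r * t \<le> 1"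
      using that(1,2) by (auto simp: scaleR_conv_of_real mult_le_one)
    then show ?thesis by (auto simp: in_segment intro!: exI[of _ "r * t"])
  qed
  have "uniform_limit ?S (\<lambda>r w. f (of_real r * w)) f (at_left 1)"
    using S star cont(1) by (intro dilation_uniform_limit compact_uniformly_continuous) auto
  then have lim: "uniform_limit ?S (\<lambda>r w. f (of_real r * w) * deriv g w) (\<lambda>w. f w * deriv g w) (at_left 1)"
    using cont by (intro uniform_lim_mult uniform_limit_const compact_imp_bounded compact_continuous_image) auto
  have "\<forall>\<^sub>F r in at_left 1. (\<lambda>w. f (of_real r * w) * deriv g w) contour_integrable_on linepath 0 z"
    using eventually_at_left_one_in_unit_interval
  proof eventually_elim
    case (elim r)
    have "continuous_on ?S (\<lambda>w. f (of_real r * w))"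
      using star elim by (intro continuous_on_compose2[OF cont(1)]) (auto intro!: continuous_intros)
    then show ?case
      using cont(2) by (intro contour_integrable_continuous_linepath continuous_on_mult)
  qed
  then show ?thesis
    unfolding T_op_def using lim
    by (intro contour_integral_uniform_limit[where B = "norm z"])
      (auto simp: vector_derivative_linepath_at)
qed

section \<open>Comparison of the two symbol classes\<close>

lemma T_symbolsE:
  assumes "g \<in> T_symbols X N"
  obtains C where "g holomorphic_on unit_disk" "\<And>f. f \<in> X \<Longrightarrow> T_op g f \<in> X"
    "\<And>f. f \<in> X \<Longrightarrow> N (T_op g f) \<le> C * N f"
  using assms unfolding T_symbols_def bounded_linear_operator_on_def H_disk_def by blast

text \<open>Applied to the constant function \<open>1\<close>, the operator returns its symbol up to a constant,
  so a symbol that acts on the disk algebra lies in it.\<close>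

lemma T_symbols_disk_algebra_subset_disk_algebra: "T_symbols disk_algebra sup_norm \<subseteq> disk_algebra"
proof
  fix g assume "g \<in> T_symbols disk_algebra sup_norm"
  then have g: "g holomorphic_on unit_disk"
    and map: "\<And>f. f \<in> disk_algebra \<Longrightarrow> T_op g f \<in> disk_algebra"
    by (auto elim: T_symbolsE)
  have "T_op g (\<lambda>_. 1) \<in> disk_algebra"
    by (intro map) (auto simp: disk_algebra_iff_uniformly_continuous uniformly_continuous_on_const)
  then have "(\<lambda>z. T_op g (\<lambda>_. 1) z + g 0) \<in> disk_algebra"
    by (rule disk_algebra_add_const)
  then show "g \<in> disk_algebra"
    using disk_algebra_cong[of "\<lambda>z. T_op g (\<lambda>_. 1) z + g 0" g] T_op_const_one[OF g] by simp
qed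

text \<open>The dilations of a bounded analytic function lie in the disk algebra and their norms do not
  exceed its norm. The bound on the disk algebra therefore holds for all of them with the same
  right-hand side, and it survives the pointwise limit \<open>r \<rightarrow> 1\<close>.\<close>

lemma T_symbols_disk_algebra_subset_T_symbols_H_infinity:
  "T_symbols disk_algebra sup_norm \<subseteq> T_symbols H_infinity sup_norm"
proof
  fix g assume "g \<in> T_symbols disk_algebra sup_norm"
  then obtain C where g: "g holomorphic_on unit_disk"
    and map: "\<And>f. f \<in> disk_algebra \<Longrightarrow> T_op g f \<in> disk_algebra"
    and C: "\<And>f. f \<in> disk_algebra \<Longrightarrow> sup_norm (T_op g f) \<le> C * sup_norm f"
    by (rule T_symbolsE) (rule that)
  have bound: "norm (T_op g f z) \<le> \<bar>C\<bar> * sup_norm f" if f: "f \<in> H_infinity" and z: "z \<in> unit_disk" for f z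
  proof -
    have hol: "f holomorphic_on unit_disk"
      using f by (auto simp: H_infinity_def H_disk_def)
    have "\<forall>\<^sub>F r in at_left 1. norm (T_op g (\<lambda>w. f (of_real r * w)) z) \<le> \<bar>C\<bar> * sup_norm f"
      using eventually_at_left_one_in_unit_interval
    proof eventually_elim
      case (elim r)
      let ?f = "\<lambda>w. f (of_real r * w)"
      have A: "?f \<in> disk_algebra"
        using hol elim by (intro dilation_in_disk_algebra) auto
      then have nonneg: "0 \<le> sup_norm ?f"
        using disk_algebra_subset_H_infinity sup_norm_nonneg by blast
      have le: "norm (?f w) \<le> sup_norm f" if "w \<in> unit_disk" for w
        using f dilation_mem[OF that, of r] elim by (intro norm_le_sup_norm) auto
      have "norm (T_op g ?f z) \<le> sup_norm (T_op g ?f)"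
        using map[OF A] disk_algebra_subset_H_infinity z by (intro norm_le_sup_norm) auto
      also have "\<dots> \<le> C * sup_norm ?f" by (rule C[OF A])
      also have "\<dots> \<le> \<bar>C\<bar> * sup_norm f"
        using sup_norm_le[OF le] nonneg by (intro mult_mono) auto
      finally show ?case .
    qed
    then show ?thesis
      using T_op_dilation_tendsto[OF hol g z]
      by (intro tendsto_upperbound[OF tendsto_norm]) auto
  qed
  have "T_op g f \<in> H_infinity" if "f \<in> H_infinity" for f
  proof -
    have "bounded (T_op g f ` unit_disk)"
      using bound[OF that] unfolding bounded_iff by blast
    then show ?thesis
      using that T_op_holomorphic[of f g] g by (simp add: H_infinity_def H_disk_def)
  qed
  moreover have "sup_norm (T_op g f) \<le> \<bar>C\<bar> * sup_norm f" if "f \<in> H_infinity" for f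
    using bound[OF that] by (rule sup_norm_le)
  ultimately show "g \<in> T_symbols H_infinity sup_norm"
    using g T_op_linear
    unfolding T_symbols_def bounded_linear_operator_on_def H_infinity_def H_disk_def
    by blast
qed

text \<open>Boundedness on \<open>H_infinity\<close> turns the uniform convergence of the dilations of \<open>f\<close> into
  uniform convergence of their images. These images lie in the disk algebra because a dilation
  has a bounded derivative, so their limit lies there as well.\<close>

lemma T_op_preserves_disk_algebra:
  assumes g: "g \<in> T_symbols H_infinity sup_norm" "g \<in> disk_algebra" and f: "f \<in> disk_algebra"
  shows "T_op g f \<in> disk_algebra"
proof -
  obtain C where hol_g: "g holomorphic_on unit_disk"
    and map: "\<And>f. f \<in> H_infinity \<Longrightarrow> T_op g f \<in> H_infinity"
    and C: "\<And>f. f \<in> H_infinity \<Longrightarrow> sup_norm (T_op g f) \<le> C * sup_norm f"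
    using g(1) by (rule T_symbolsE) (rule that)
  have hol: "f holomorphic_on unit_disk" and uc: "uniformly_continuous_on unit_disk f"
    using f by (auto simp: disk_algebra_iff_uniformly_continuous)
  define fr where "fr r w = f (of_real r * w)" for r :: real and w :: complex
  have frA: "fr r \<in> disk_algebra" if "r \<in> {0<..<1}" for r
    unfolding fr_def using that hol by (intro dilation_in_disk_algebra) auto
  have "\<forall>\<^sub>F r in at_left 1. T_op g (fr r) \<in> disk_algebra"
    using eventually_at_left_one_in_unit_interval
  proof eventually_elim
    case (elim r)
    then have "bounded (deriv (fr r) ` unit_disk)"
      unfolding fr_def using hol by (intro dilation_deriv_bounded) auto
    then show ?case
      using frA[OF elim] g(2) by (intro T_op_in_disk_algebra)
  qed
  moreover have "uniform_limit unit_disk (\<lambda>r. T_op g (fr r)) (T_op g f) (at_left 1)"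
    unfolding uniform_limit_iff
  proof (intro allI impI)
    fix e :: real assume "0 < e"
    \<comment> \<open>The summand \<open>1\<close> keeps the denominator positive, since \<open>C\<close> may be \<open>0\<close>.\<close>
    define d where "d = e / (\<bar>C\<bar> + 1)"
    have "d > 0" using \<open>0 < e\<close> by (simp add: d_def)
    have "uniform_limit unit_disk fr f (at_left 1)"
      unfolding fr_def using uc dilation_mem by (intro dilation_uniform_limit) blast+
    then have "\<forall>\<^sub>F r in at_left 1. \<forall>w\<in>unit_disk. dist (fr r w) (f w) < d"
      using \<open>d > 0\<close> by (simp add: uniform_limit_iff)
    with eventually_at_left_one_in_unit_interval
    show "\<forall>\<^sub>F r in at_left 1. \<forall>z\<in>unit_disk. dist (T_op g (fr r) z) (T_op g f z) < e"
    proof eventually_elim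
      case (elim r)
      \<comment> \<open>The difference \<open>fr r - f\<close>, in the shape of a linear combination.\<close>
      define h where "h w = 1 * fr r w + (- 1) * f w" for w
      have "h \<in> disk_algebra"
        unfolding h_def using disk_algebra_diff[OF frA[OF elim(1)] f] by simp
      then have h: "h \<in> H_infinity"
        using disk_algebra_subset_H_infinity by blast
      have "norm (h w) \<le> d" if "w \<in> unit_disk" for w
        using elim(2) that by (auto simp: h_def dist_norm intro: less_imp_le)
      then have "sup_norm h \<le> d" by (rule sup_norm_le)
      show ?case
      proof
        fix z assume z: "z \<in> unit_disk"
        have "T_op g h z = 1 * T_op g (fr r) z + (- 1) * T_op g f z"
          unfolding h_def using frA[OF elim(1)] hol hol_g z
          by (intro T_op_linear) (auto simp: disk_algebra_iff_uniformly_continuous)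
        then have "dist (T_op g (fr r) z) (T_op g f z) = norm (T_op g h z)"
          by (simp add: dist_norm)
        also have "\<dots> \<le> sup_norm (T_op g h)"
          using map[OF h] z by (rule norm_le_sup_norm)
        also have "\<dots> \<le> C * sup_norm h" by (rule C[OF h])
        also have "\<dots> \<le> \<bar>C\<bar> * d"
          using sup_norm_nonneg[OF h] \<open>sup_norm h \<le> d\<close> by (intro mult_mono) auto
        also have "\<dots> < e"
          using \<open>0 < e\<close> by (simp add: d_def field_simps)
        finally show "dist (T_op g (fr r) z) (T_op g f z) < e" .
      qed
    qed
  qed
  ultimately show ?thesis
    using T_op_holomorphic[OF hol hol_g]
    by (intro disk_algebra_uniform_limit[where F = "at_left (1::real)"]) auto
qed

theorem proposition2p17:
  shows "T_symbols disk_algebra sup_norm = T_symbols H_infinity sup_norm \<inter> disk_algebra"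
proof
  show "T_symbols disk_algebra sup_norm \<subseteq> T_symbols H_infinity sup_norm \<inter> disk_algebra"
    using T_symbols_disk_algebra_subset_T_symbols_H_infinity
      T_symbols_disk_algebra_subset_disk_algebra by blast
next
  show "T_symbols H_infinity sup_norm \<inter> disk_algebra \<subseteq> T_symbols disk_algebra sup_norm"
  proof
    fix g assume "g \<in> T_symbols H_infinity sup_norm \<inter> disk_algebra"
    then have "g \<in> H_disk" "bounded_linear_operator_on H_infinity sup_norm (T_op g)"
      "\<forall>f\<in>disk_algebra. T_op g f \<in> disk_algebra"
      using T_op_preserves_disk_algebra by (auto simp: T_symbols_def)
    then show "g \<in> T_symbols disk_algebra sup_norm"
      using disk_algebra_subset_H_infinity
      unfolding T_symbols_def bounded_linear_operator_on_def by blast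
  qed
qed

end
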